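(* Let $G$ be a finite simple graph with $m$ edges and adjacency matrix $A$. Let $s^+$ denote the sum of the squares of the positive eigenvalues of $A$ and $s^-$ the sum of the squares of the negative eigenvalues of $A$ (eigenvalues counted with multiplicity). Then \[ \min\{s^+,s^-\} \geq \frac{2m}{\chi_{\mathrm{vec}}(G)}. \]
   Context: For a finite simple graph $G$ with adjacency matrix $A$, let $\overline{A}$ be the adjacency matrix of the complement of $G$, $J$ the all-ones matrix, $I$ the identity matrix, $\langle X,Y\rangle=\operatorname{tr}(X^TY)$ the trace inner product, and $\circ$ the entrywise (Hadamard) product. The vector chromatic number $\chi_{\mathrm{vec}}(G)$ is defined as the optimal value of the semidefinite program: maximize $\langle J, Z\rangle$ over real symmetric matrices $Z$ indexed by $V(G)$ subject to $\langle I, Z\rangle = 1$, $Z\circ \overline{A} = 0$, $Z \geq 0$ (entrywise nonnegative), and $Z \succeq 0$ (positive semidefinite). *)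

theory Defs
  imports "HOL-Analysis.Analysis"
begin

unbundle no fps_syntax

text \<open>
  The vertex set is the finite type \<^typ>\<open>'n\<close> (hence nonempty), and a graph is given by its
  edge set, a set of two-element sets of vertices.
\<close>

definition simple_graph :: "'n::finite set set \<Rightarrow> bool" where
  "simple_graph E \<longleftrightarrow> (\<forall>e\<in>E. card e = 2)"

definition complement_graph :: "'n::finite set set \<Rightarrow> 'n set set" where
  "complement_graph E = {e. card e = 2} - E"

text \<open>For \<open>i = j\<close> the set \<open>{i, j}\<close> is a singleton, so the diagonal is zero for a simple graph.\<close>

definition adjacency_matrix :: "'n::finite set set \<Rightarrow> real^'n^'n" where
  "adjacency_matrix E = (\<chi> i j. if {i, j} \<in> E then 1 else 0)"


definition charpoly :: "real^'n^'n \<Rightarrow> real poly" where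
  "charpoly A = det (mat [:0, 1:] - map_matrix (\<lambda>a. [:a:]) A)"

text \<open>
  The real eigenvalues with algebraic multiplicity; these are all the eigenvalues when
  \<open>A\<close> is symmetric.
\<close>

definition eigenvalues :: "real^'n^'n \<Rightarrow> real multiset" where
  "eigenvalues A = proots (charpoly A)"

definition s_plus :: "real^'n^'n \<Rightarrow> real" where
  "s_plus A = (\<Sum>x\<in>#filter_mset (\<lambda>x. x > 0) (eigenvalues A). x\<^sup>2)"

definition s_minus :: "real^'n^'n \<Rightarrow> real" where
  "s_minus A = (\<Sum>x\<in>#filter_mset (\<lambda>x. x < 0) (eigenvalues A). x\<^sup>2)"


definition trace_inner :: "real^'n^'n \<Rightarrow> real^'n^'n \<Rightarrow> real" where
  "trace_inner X Y = trace (transpose X ** Y)"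

definition hadamard :: "real^'n^'n \<Rightarrow> real^'n^'n \<Rightarrow> real^'n^'n" where
  "hadamard X Y = (\<chi> i j. X $ i $ j * Y $ i $ j)"

definition all_ones :: "real^'n^'n" where
  "all_ones = (\<chi> i j. 1)"

definition psd :: "real^'n^'n \<Rightarrow> bool" where
  "psd Z \<longleftrightarrow> transpose Z = Z \<and> (\<forall>x. 0 \<le> x \<bullet> (Z *v x))"

definition vec_feasible :: "'n::finite set set \<Rightarrow> (real^'n^'n) set" where
  "vec_feasible E = {Z. transpose Z = Z
     \<and> trace_inner (mat 1) Z = 1
     \<and> hadamard Z (adjacency_matrix (complement_graph E)) = 0
     \<and> (\<forall>i j. 0 \<le> Z $ i $ j)
     \<and> psd Z}"

definition chi_vec :: "'n::finite set set \<Rightarrow> real" where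
  "chi_vec E = (SUP Z \<in> vec_feasible E. trace_inner all_ones Z)"


text \<open>The roots of \<^const>\<open>charpoly\<close> are the eigenvalues.\<close>

lemma poly_charpoly: "poly (charpoly A) x = det (mat x - A)"
  unfolding charpoly_def det_def
  by (simp add: poly_sum poly_prod mat_def if_distrib[of "\<lambda>p. poly p x"] cong: if_cong)

lemma poly_charpoly_eq_0_iff:
  "poly (charpoly A) x = 0 \<longleftrightarrow> (\<exists>v. v \<noteq> 0 \<and> A *v v = x *s v)"
proof -
  have "(mat x - A) *v v = x *s v - A *v v" for v
  proof -
    have "mat x *v v = x *s v"
      by (simp add: vec_eq_iff matrix_vector_mult_def mat_def if_distrib[where f = "\<lambda>y. y * _"] if_distrib[where f = "(*) _"] cong: if_cong)
    then show ?thesis by (simp add: matrix_vector_mult_diff_rdistrib)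
  qed
  then show ?thesis
    unfolding poly_charpoly
    using invertible_det_nz[of "mat x - A"] invertible_left_inverse[of "mat x - A"]
      matrix_left_invertible_ker[of "mat x - A"]
    by (metis eq_iff_diff_eq_0)
qed

lemma trace_inner_eq_sum: "trace_inner X Y = (\<Sum>i\<in>UNIV. \<Sum>j\<in>UNIV. X $ i $ j * Y $ i $ j)"
  unfolding trace_inner_def trace_def matrix_matrix_mult_def transpose_def
  by (simp, rule sum.swap)

text \<open>
  The feasible set is nonempty and the objective is bounded on it, so the supremum in
  \<^const>\<open>chi_vec\<close> is a genuine one.
\<close>

lemma vec_feasible_nonempty:
  fixes E :: "'n::finite set set"
  shows "mat (1 / real CARD('n)) \<in> vec_feasible E"
proof -
  let ?c = "1 / real CARD('n)"
  have mv: "(mat ?c :: real^'n^'n) *v x = ?c *\<^sub>R x" for x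
    by (simp add: vec_eq_iff matrix_vector_mult_def mat_def if_distrib[where f = "\<lambda>y. y * _"] if_distrib[where f = "(*) _"] cong: if_cong)
  have "psd (mat ?c :: real^'n^'n)"
    unfolding psd_def by (simp add: mv transpose_mat)
  moreover have "trace_inner (mat 1) (mat ?c :: real^'n^'n) = 1"
    by (simp add: trace_inner_eq_sum mat_def if_distrib[where f = "\<lambda>y. y * _"] if_distrib[where f = "(*) _"] cong: if_cong)
  moreover have "hadamard (mat ?c) (adjacency_matrix (complement_graph E)) = 0"
    by (auto simp: hadamard_def adjacency_matrix_def complement_graph_def mat_def vec_eq_iff)
  ultimately show ?thesis
    by (simp add: vec_feasible_def transpose_mat) (simp add: mat_def)
qed

lemma bdd_above_vec_feasible:
  fixes E :: "'n::finite set set"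
  shows "bdd_above (trace_inner all_ones ` vec_feasible E)"
proof (rule bdd_aboveI2)
  fix Z assume "Z \<in> vec_feasible E"
  then have Z: "transpose Z = Z" "\<And>x. 0 \<le> x \<bullet> (Z *v x)" "trace_inner (mat 1) Z = 1"
    by (auto simp: vec_feasible_def psd_def)
  have sym: "Z $ j $ i = Z $ i $ j" for i j
    using Z(1) by (metis transpose_def vec_lambda_beta)
  have tr: "(\<Sum>i\<in>UNIV. Z $ i $ i) = 1"
    using Z(3) by (simp add: trace_inner_eq_sum mat_def if_distrib[where f = "\<lambda>y. y * _"] if_distrib[where f = "(*) _"] cong: if_cong)
  have le: "2 * Z $ i $ j \<le> Z $ i $ i + Z $ j $ j" for i j
  proof -
    have ip: "axis a 1 \<bullet> (Z *v axis b 1) = Z $ a $ b" for a b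
      by (simp add: inner_axis' matrix_vector_mult_basis column_def)
    have "0 \<le> (axis i 1 - axis j 1) \<bullet> (Z *v (axis i 1 - axis j 1))" by (rule Z(2))
    then show ?thesis
      by (simp add: matrix_vector_mult_diff_distrib inner_diff_left inner_diff_right ip sym[of j i])
  qed
  have "2 * trace_inner all_ones Z = (\<Sum>i\<in>UNIV. \<Sum>j\<in>UNIV. 2 * Z $ i $ j)"
    by (simp add: trace_inner_eq_sum all_ones_def sum_distrib_left)
  also have "\<dots> \<le> (\<Sum>i\<in>UNIV. \<Sum>j\<in>UNIV. Z $ i $ i + Z $ j $ j)"
    by (intro sum_mono le)
  also have "\<dots> = 2 * real CARD('n)"
    by (simp add: sum.distrib tr flip: sum_distrib_left)
  finally show "trace_inner all_ones Z \<le> real CARD('n)" by simp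
qed

end

theory Submission
  imports Defs
begin

text \<open>
  Split \<open>A = X - Y\<close> into its positive and negative parts, so that \<open>X\<close> and \<open>Y\<close> are positive
  semidefinite and orthogonal, with squared norms \<open>s\<^sup>+\<close> and \<open>s\<^sup>-\<close>. Off the edges of the graph
  (in particular on the diagonal) \<open>X\<close> and \<open>Y\<close> agree; let \<open>D\<close> be the sum of their squared
  entries there. By orthogonality the entries at edges contribute \<open>- D\<close> to the inner product,
  and Cauchy-Schwarz on the edges gives \<open>D\<^sup>2 \<le> (s\<^sup>+ - D) (s\<^sup>- - D)\<close>, that is,
  \<open>2 m D \<le> s\<^sup>+ s\<^sup>-\<close>. Conversely, the Schur square of \<open>X\<close> yields a feasible matrix showing
  \<open>s\<^sup>+ \<le> D \<chi>\<close>, where \<open>\<chi>\<close> is the vector chromatic number, and likewise for \<open>Y\<close>.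
\<close>

section \<open>The spectral theorem for real symmetric matrices\<close>

lemma symmetric_inner_swap:
  fixes A :: "real^'n^'n"
  assumes "transpose A = A"
  shows "(A *v x) \<bullet> y = x \<bullet> (A *v y)"
  by (metis assms dot_lmul_matrix transpose_matrix_vector)

text \<open>Along the line through \<open>v\<close> in direction \<open>u\<close> the form is a
  nonnegative quadratic in the parameter that vanishes at \<open>v\<close>, so its linear
  coefficient is zero. Positivity is asked only on \<open>S\<close>, so that the result applies
  inside an invariant subspace.\<close>

lemma psd_form_isotropic:
  fixes A :: "real^'n^'n"
  assumes "transpose A = A" "subspace S"
    and "\<And>x. x \<in> S \<Longrightarrow> 0 \<le> x \<bullet> (A *v x)"
    and "v \<in> S" "u \<in> S" "v \<bullet> (A *v v) = 0"
  shows "u \<bullet> (A *v v) = 0"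
proof (rule ccontr)
  define b where "b = u \<bullet> (A *v v)"
  define q where "q = u \<bullet> (A *v u)"
  assume "u \<bullet> (A *v v) \<noteq> 0"
  then have "b \<noteq> 0" by (simp add: b_def)
  have pos: "0 \<le> 2 * t * b + t\<^sup>2 * q" for t
  proof -
    have "v + t *\<^sub>R u \<in> S"
      using assms by (simp add: subspace_add subspace_scale)
    then have "0 \<le> (v + t *\<^sub>R u) \<bullet> (A *v (v + t *\<^sub>R u))" by (rule assms(3))
    also have "\<dots> = 2 * t * b + t\<^sup>2 * q"
      using symmetric_inner_swap[OF assms(1), of v u] assms(6)
      by (simp add: b_def q_def matrix_vector_right_distrib inner_add_left inner_add_right
          matrix_vector_mult_scaleR power2_eq_square inner_commute algebra_simps)
    finally show ?thesis .
  qed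
  have "0 \<le> q" using assms(3)[OF assms(5)] by (simp add: q_def)
  \<comment> \<open>The minimiser would be \<open>- b / q\<close>; the denominator
    \<open>q + 1\<close> stays positive when \<open>q = 0\<close> and still makes the value
    negative.\<close>
  have "0 \<le> 2 * (- b / (q + 1)) * b + (- b / (q + 1))\<^sup>2 * q" by (rule pos)
  also have "\<dots> = - (b\<^sup>2 * (q + 2)) / (q + 1)\<^sup>2"
    using \<open>0 \<le> q\<close> by (simp add: divide_simps) (simp add: power2_eq_square algebra_simps)
  also have "\<dots> < 0"
    using \<open>0 \<le> q\<close> \<open>b \<noteq> 0\<close> by (simp add: divide_neg_pos)
  finally show False by simp
qed

text \<open>The form of \<open>A\<close> attains a maximum \<open>c\<close> on the compact unit
  sphere of \<open>S\<close>, say at \<open>v\<close>. The form of \<open>mat c - A\<close> is then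
  nonnegative on \<open>S\<close> and vanishes at \<open>v\<close>, which forces \<open>v\<close> to
  be an eigenvector.\<close>

lemma symmetric_invariant_subspace_eigenvector:
  fixes A :: "real^'n^'n"
  assumes sym: "transpose A = A" and S: "subspace S" "S \<noteq> {0}"
    and inv: "\<And>x. x \<in> S \<Longrightarrow> A *v x \<in> S"
  obtains v c where "v \<in> S" "norm v = 1" "A *v v = c *\<^sub>R v"
proof -
  let ?K = "S \<inter> sphere 0 1"
  obtain w where "w \<in> S" "w \<noteq> 0" using S subspace_0 by blast
  then have "(1 / norm w) *\<^sub>R w \<in> ?K" using S by (simp add: subspace_scale)
  then have "?K \<noteq> {}" by blast
  moreover have "compact ?K"
    using S by (metis closed_Int_compact closed_subspace compact_sphere)
  moreover have "continuous_on ?K (\<lambda>x. x \<bullet> (A *v x))"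
    by (intro continuous_intros matrix_vector_mult_linear_continuous_on)
  ultimately obtain v where v: "v \<in> ?K"
      and max: "\<And>y. y \<in> ?K \<Longrightarrow> y \<bullet> (A *v y) \<le> v \<bullet> (A *v v)"
    using continuous_attains_sup[of ?K "\<lambda>x. x \<bullet> (A *v x)"] by blast
  define c where "c = v \<bullet> (A *v v)"
  define C where "C = mat c - A"
  have C: "C *v x = c *\<^sub>R x - A *v x" for x
    by (simp add: C_def matrix_vector_mult_diff_rdistrib)
       (simp add: vec_eq_iff matrix_vector_mult_def mat_def if_distrib[where f = "\<lambda>y. y * _"]
         if_distrib[where f = "(*) _"] cong: if_cong)
  have "v \<in> S" "norm v = 1" using v by auto
  then have vv: "v \<bullet> v = 1" by (simp add: norm_eq_1)
  have "transpose C = C"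
    using sym by (simp add: C_def vec_eq_iff transpose_def mat_def)
  moreover have "0 \<le> x \<bullet> (C *v x)" if "x \<in> S" for x
  proof (cases "x = 0")
    case False
    then have "(1 / norm x) *\<^sub>R x \<in> ?K" using S that by (simp add: subspace_scale)
    from max[OF this] have "(x \<bullet> (A *v x)) / (norm x)\<^sup>2 \<le> c"
      by (simp add: c_def matrix_vector_mult_scaleR power2_eq_square)
    then have "x \<bullet> (A *v x) \<le> c * (norm x)\<^sup>2" using False by (simp add: divide_simps)
    then show ?thesis by (simp add: C inner_diff_right power2_norm_eq_inner)
  qed simp
  moreover have "C *v v \<in> S"
    using S inv \<open>v \<in> S\<close> by (simp add: C subspace_diff subspace_scale)
  moreover have "v \<bullet> (C *v v) = 0" by (simp add: C inner_diff_right vv c_def)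
  \<comment> \<open>Invariance puts \<open>C *v v\<close> in \<open>S\<close>, so it can itself
    serve as the test vector \<open>u\<close>.\<close>
  ultimately have "(C *v v) \<bullet> (C *v v) = 0"
    using psd_form_isotropic S(1) \<open>v \<in> S\<close> by blast
  then have "A *v v = c *\<^sub>R v" by (simp add: C)
  then show thesis using that \<open>v \<in> S\<close> \<open>norm v = 1\<close> by blast
qed

text \<open>A largest orthonormal set of eigenvectors must span: otherwise its orthogonal complement
  is a nonzero invariant subspace, and a unit eigenvector found there would enlarge the set.\<close>

lemma symmetric_orthonormal_eigenbasis:
  fixes A :: "real^'n^'n"
  assumes sym: "transpose A = A"
  obtains v :: "'n \<Rightarrow> real^'n" and d where
    "\<And>k l. v k \<bullet> v l = (if k = l then 1 else 0)" "\<And>k. A *v v k = d k *\<^sub>R v k"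
proof -
  define P where "P B \<longleftrightarrow> pairwise orthogonal B \<and> (\<forall>x\<in>B. norm x = 1 \<and> (\<exists>c. A *v x = c *\<^sub>R x))"
    for B
  have indep: "independent B" if "P B" for B
    using that by (intro pairwise_orthogonal_independent) (auto simp: P_def)
  then have bound: "card B \<le> DIM(real^'n)" if "P B" for B
    using that independent_bound by blast
  have "P {}" by (simp add: P_def)
  then obtain B where B: "P B" and max: "\<And>B'. P B' \<Longrightarrow> card B' \<le> card B"
    using ex_has_greatest_nat[of P "{}" card "Suc (DIM(real^'n))"] bound
    by (metis le_imp_less_Suc)
  have "finite B" using indep[OF B] by (rule independent_imp_finite)
  have "span B = UNIV"
  proof (rule ccontr)
    define S where "S = {x. \<forall>b\<in>B. orthogonal b x}"
    assume "span B \<noteq> UNIV"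
    then obtain a where "a \<noteq> 0" "\<forall>x\<in>span B. a \<bullet> x = 0"
      using span_not_UNIV_orthogonal by blast
    then have "a \<in> S" by (auto simp: S_def orthogonal_def span_base inner_commute)
    then have "S \<noteq> {0}" using \<open>a \<noteq> 0\<close> by blast
    moreover have "subspace S"
      by (auto simp: S_def subspace_def orthogonal_def inner_add_right)
    moreover have "A *v x \<in> S" if "x \<in> S" for x
    proof -
      have "b \<bullet> (A *v x) = 0" if "b \<in> B" for b
      proof -
        obtain c where "A *v b = c *\<^sub>R b" using B \<open>b \<in> B\<close> by (auto simp: P_def)
        then show ?thesis
          using \<open>x \<in> S\<close> \<open>b \<in> B\<close> symmetric_inner_swap[OF sym, of b x]
          by (simp add: S_def orthogonal_def)
      qed
      then show ?thesis by (simp add: S_def orthogonal_def)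
    qed
    ultimately obtain v c where v: "v \<in> S" "norm v = 1" "A *v v = c *\<^sub>R v"
      using symmetric_invariant_subspace_eigenvector[OF sym, of S] by blast
    have "v \<notin> B" using v by (auto simp: S_def orthogonal_def)
    have "P (insert v B)"
      using B v by (auto simp: P_def pairwise_insert S_def orthogonal_commute)
    from max[OF this] show False using \<open>v \<notin> B\<close> \<open>finite B\<close> by simp
  qed
  then have "card B = CARD('n)"
    using dim_span_eq_card_independent[OF indep[OF B]] by simp
  then obtain v where v: "bij_betw v (UNIV :: 'n set) B"
    using finite_same_card_bij[OF finite \<open>finite B\<close>] by auto
  then have vB: "v k \<in> B" for k by (auto simp: bij_betw_def)
  have "v k \<bullet> v l = (if k = l then 1 else 0)" for k l
  proof (cases "k = l")
    case True
    then show ?thesis using B vB[of k] by (simp add: P_def norm_eq_1)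
  next
    case False
    then have "v k \<noteq> v l" using v by (simp add: bij_betw_def inj_eq)
    then have "orthogonal (v k) (v l)"
      using B vB[of k] vB[of l] unfolding P_def pairwise_def by blast
    then show ?thesis using False by (simp add: orthogonal_def)
  qed
  moreover have "\<forall>k. \<exists>c. A *v v k = c *\<^sub>R v k"
    using B vB by (simp add: P_def)
  then obtain d where "\<And>k. A *v v k = d k *\<^sub>R v k" by metis
  ultimately show thesis using that by blast
qed

section \<open>Eigenvalue multisets and spectral decompositions\<close>

lemma orthonormal_family_dual:
  fixes v :: "'n::finite \<Rightarrow> real^'n"
  assumes "\<And>k l. v k \<bullet> v l = (if k = l then 1 else 0)"
  shows "(\<Sum>k\<in>UNIV. v k $ i * v k $ j) = (if i = j then 1 else 0)"
proof -
  define P :: "real^'n^'n" where "P = (\<chi> k i. v k $ i)"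
  have "P ** transpose P = mat 1"
    using assms by (simp add: P_def vec_eq_iff matrix_matrix_mult_def transpose_def mat_def inner_vec_def)
  \<comment> \<open>A one-sided inverse of a square matrix is two-sided, so orthonormal rows force
    orthonormal columns.\<close>
  then have "transpose P ** P = mat 1" by (simp add: matrix_left_right_inverse)
  then have "(transpose P ** P) $ i $ j = (if i = j then 1 else 0)" by (simp add: mat_def)
  then show ?thesis by (simp add: P_def matrix_matrix_mult_def transpose_def)
qed

text \<open>The matrix \<open>P\<close> with columns \<open>v k\<close> intertwines
  \<open>mat x - A\<close> with a diagonal matrix, and cancelling \<open>det P\<close> gives the
  determinant at each real \<open>x\<close>. Polynomials that agree at every real number are
  equal.\<close>

lemma charpoly_orthonormal_eigenbasis:
  fixes A :: "real^'n^'n" and v :: "'n \<Rightarrow> real^'n"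
  assumes on: "\<And>k l. v k \<bullet> v l = (if k = l then 1 else 0)"
    and ev: "\<And>k. A *v v k = d k *\<^sub>R v k"
  shows "charpoly A = (\<Prod>k\<in>UNIV. [:- d k, 1:])"
proof -
  define P :: "real^'n^'n" where "P = (\<chi> i k. v k $ i)"
  have PP: "transpose P ** P = mat 1"
    using on by (simp add: P_def vec_eq_iff matrix_matrix_mult_def transpose_def mat_def inner_vec_def)
  have "det (mat x - A) = (\<Prod>k\<in>UNIV. x - d k)" for x
  proof -
    let ?D = "(\<chi> i k. if i = k then x - d k else 0) :: real^'n^'n"
    have AP: "(\<Sum>j\<in>UNIV. A $ i $ j * v k $ j) = d k * v k $ i" for i k
      using ev[of k] by (simp add: vec_eq_iff matrix_vector_mult_def)
    have "(mat x - A) ** P = P ** ?D"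
      by (simp add: vec_eq_iff matrix_matrix_mult_def P_def mat_def left_diff_distrib sum_subtractf AP
          if_distrib[where f = "\<lambda>y. y * _"] if_distrib[where f = "(*) _"] cong: if_cong)
         (simp add: algebra_simps)
    from arg_cong[OF this, of det] have "det (mat x - A) * det P = det P * det ?D"
      by (simp only: det_mul)
    moreover have "det P \<noteq> 0"
      using arg_cong[OF PP, of det] by (auto simp: det_mul)
    moreover have "det ?D = (\<Prod>k\<in>UNIV. x - d k)"
      by (subst det_diagonal) auto
    ultimately show ?thesis by simp
  qed
  then have "poly (charpoly A) = poly (\<Prod>k\<in>UNIV. [:- d k, 1:])"
    by (simp add: fun_eq_iff poly_charpoly poly_prod)
  then show ?thesis using poly_eq_poly_eq_iff by blast
qed

text \<open>This turns the multiset of roots, multiplicities included, into the indexed family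
  \<open>d\<close>, so that \<open>s_plus\<close> and \<open>s_minus\<close> become sums over
  indices.\<close>

lemma eigenvalues_orthonormal_eigenbasis:
  fixes A :: "real^'n^'n" and v :: "'n \<Rightarrow> real^'n"
  assumes "\<And>k l. v k \<bullet> v l = (if k = l then 1 else 0)"
    and "\<And>k. A *v v k = d k *\<^sub>R v k"
  shows "eigenvalues A = image_mset d (mset_set UNIV)"
proof -
  have "proots (\<Prod>k\<in>K. [:- d k, 1:]) = image_mset d (mset_set K)" if "finite K" for K
    using that
  proof (induction K rule: finite_induct)
    case (insert k K)
    have "[:- d k, 1:] * (\<Prod>k\<in>K. [:- d k, 1:]) \<noteq> 0"
      using insert by (simp add: prod_zero_iff del: mult_pCons_left)
    then show ?case using insert by (simp add: proots_mult del: mult_pCons_left)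
  qed simp
  then show ?thesis
    by (simp add: eigenvalues_def charpoly_orthonormal_eigenbasis[OF assms])
qed

text \<open>For orthonormal \<open>v\<close> this is the functional calculus: the sum of
  \<open>f k\<close> times the projection onto \<open>v k\<close>. Fixing \<open>v\<close> and
  varying \<open>f\<close> yields a symmetric matrix and its positive and negative parts.\<close>

definition spectral_matrix :: "('n::finite \<Rightarrow> real^'n) \<Rightarrow> ('n \<Rightarrow> real) \<Rightarrow> real^'n^'n" where
  "spectral_matrix v f = (\<chi> i j. \<Sum>k\<in>UNIV. f k * (v k $ i * v k $ j))"

lemma spectral_matrix_eigenbasis:
  fixes A :: "real^'n^'n" and v :: "'n \<Rightarrow> real^'n"
  assumes on: "\<And>k l. v k \<bullet> v l = (if k = l then 1 else 0)"
    and ev: "\<And>k. A *v v k = d k *\<^sub>R v k"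
  shows "spectral_matrix v d = A"
proof -
  have "(\<Sum>k\<in>UNIV. d k * (v k $ i * v k $ j)) = A $ i $ j" for i j
  proof -
    have "(\<Sum>k\<in>UNIV. d k * (v k $ i * v k $ j)) = (\<Sum>k\<in>UNIV. (A *v v k) $ i * v k $ j)"
      by (simp add: ev mult.assoc)
    also have "\<dots> = (\<Sum>k\<in>UNIV. \<Sum>l\<in>UNIV. A $ i $ l * (v k $ l * v k $ j))"
      by (simp add: matrix_vector_mult_def sum_distrib_right mult.assoc)
    also have "\<dots> = (\<Sum>l\<in>UNIV. A $ i $ l * (\<Sum>k\<in>UNIV. v k $ l * v k $ j))"
      by (subst sum.swap) (simp add: sum_distrib_left)
    also have "\<dots> = A $ i $ j"
      by (simp add: orthonormal_family_dual[OF on] if_distrib[where f = "(*) _"] cong: if_cong)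
    finally show ?thesis .
  qed
  then show ?thesis by (simp add: spectral_matrix_def vec_eq_iff)
qed

lemma sum_swap_pairs:
  "(\<Sum>i\<in>I. \<Sum>j\<in>J. \<Sum>k\<in>K. \<Sum>l\<in>L. t i j k l) = (\<Sum>k\<in>K. \<Sum>l\<in>L. \<Sum>i\<in>I. \<Sum>j\<in>J. t i j k l)"
proof -
  have "(\<Sum>i\<in>I. \<Sum>j\<in>J. \<Sum>k\<in>K. \<Sum>l\<in>L. t i j k l) = (\<Sum>i\<in>I. \<Sum>k\<in>K. \<Sum>l\<in>L. \<Sum>j\<in>J. t i j k l)"
    by (intro sum.cong refl) (subst sum.swap, intro sum.cong refl sum.swap)
  also have "\<dots> = (\<Sum>k\<in>K. \<Sum>l\<in>L. \<Sum>i\<in>I. \<Sum>j\<in>J. t i j k l)"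
    by (subst sum.swap, intro sum.cong refl sum.swap)
  finally show ?thesis .
qed

text \<open>The entrywise product of the rank-one matrices of \<open>v k\<close> and
  \<open>v l\<close> is the rank-one matrix of their entrywise product, so the form is a combination
  of squares. Constant weights give trace inner products, general ones the Schur product
  theorem.\<close>

lemma sum_spectral_matrix_product:
  "(\<Sum>i\<in>UNIV. \<Sum>j\<in>UNIV. x i * x j * (spectral_matrix v f $ i $ j * spectral_matrix v g $ i $ j))
    = (\<Sum>k\<in>UNIV. \<Sum>l\<in>UNIV. f k * g l * (\<Sum>i\<in>UNIV. x i * (v k $ i * v l $ i))\<^sup>2)"
proof -
  have entry: "spectral_matrix v f $ i $ j * spectral_matrix v g $ i $ j
    = (\<Sum>k\<in>UNIV. \<Sum>l\<in>UNIV. (f k * (v k $ i * v k $ j)) * (g l * (v l $ i * v l $ j)))" for i j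
    by (simp add: spectral_matrix_def sum_product)
  have "(\<Sum>i\<in>UNIV. \<Sum>j\<in>UNIV. x i * x j * (spectral_matrix v f $ i $ j * spectral_matrix v g $ i $ j))
    = (\<Sum>i\<in>UNIV. \<Sum>j\<in>UNIV. \<Sum>k\<in>UNIV. \<Sum>l\<in>UNIV.
        f k * g l * ((x i * (v k $ i * v l $ i)) * (x j * (v k $ j * v l $ j))))"
    by (simp add: entry sum_distrib_left mult_ac)
  also have "\<dots> = (\<Sum>k\<in>UNIV. \<Sum>l\<in>UNIV. f k * g l * (\<Sum>i\<in>UNIV. x i * (v k $ i * v l $ i))\<^sup>2)"
    by (subst sum_swap_pairs) (simp only: power2_eq_square sum_product, simp only: sum_distrib_left)
  finally show ?thesis .
qed

lemma trace_inner_spectral_matrix: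
  assumes on: "\<And>k l. v k \<bullet> v l = (if k = l then 1 else 0)"
  shows "trace_inner (spectral_matrix v f) (spectral_matrix v g) = (\<Sum>k\<in>UNIV. f k * g k)"
proof -
  have "(\<Sum>i\<in>UNIV. v k $ i * v l $ i) = (if k = l then 1 else 0)" for k l
    using on[of k l] by (simp add: inner_vec_def)
  then show ?thesis
    using sum_spectral_matrix_product[of "\<lambda>_. 1" v f g]
    by (simp add: trace_inner_eq_sum if_distrib[where f = "\<lambda>y. y\<^sup>2"] if_distrib[where f = "(*) _"] cong: if_cong)
qed

section \<open>Positive semidefiniteness and the Schur product\<close>

lemma inner_matrix_vector_eq_sum:
  fixes A :: "real^'n^'n"
  shows "x \<bullet> (A *v x) = (\<Sum>i\<in>UNIV. \<Sum>j\<in>UNIV. x $ i * x $ j * A $ i $ j)"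
  by (simp add: inner_vec_def matrix_vector_mult_def sum_distrib_left algebra_simps)

lemma transpose_eq_iff: "transpose A = A \<longleftrightarrow> (\<forall>i j. A $ i $ j = A $ j $ i)"
  by (auto simp: transpose_def vec_eq_iff)

lemma psd_spectral_matrix:
  assumes "\<And>k. 0 \<le> f k"
  shows "psd (spectral_matrix v f)"
proof -
  have "0 \<le> x \<bullet> (spectral_matrix v f *v x)" for x
  proof -
    have "x \<bullet> (spectral_matrix v f *v x)
        = (\<Sum>i\<in>UNIV. \<Sum>j\<in>UNIV. \<Sum>k\<in>UNIV. f k * ((x $ i * v k $ i) * (x $ j * v k $ j)))"
      by (simp add: inner_matrix_vector_eq_sum spectral_matrix_def sum_distrib_left algebra_simps)
    also have "\<dots> = (\<Sum>k\<in>UNIV. f k * (\<Sum>i\<in>UNIV. x $ i * v k $ i)\<^sup>2)"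
      \<comment> \<open>The one-element index set \<open>{()}\<close> makes the four-fold exchange
        serve for three sums.\<close>
      using sum_swap_pairs[where t = "\<lambda>i j k l. f k * ((x $ i * v k $ i) * (x $ j * v k $ j))"
          and L = "{()}" and I = UNIV and J = UNIV and K = UNIV]
      unfolding power2_eq_square sum_product unfolding sum_distrib_left by simp
    also have "\<dots> \<ge> 0" using assms by (simp add: sum_nonneg)
    finally show ?thesis .
  qed
  then show ?thesis
    by (simp add: psd_def transpose_eq_iff) (simp add: spectral_matrix_def mult.commute)
qed

text \<open>Schur product theorem for a square: in an eigenbasis the form is a sum of squares
  weighted by products \<open>d k * d l\<close> of nonnegative eigenvalues.\<close>

lemma psd_hadamard_self:
  fixes X :: "real^'n^'n"
  assumes "psd X"
  shows "psd (hadamard X X)"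
proof -
  have sym: "transpose X = X" and pos: "\<And>x. 0 \<le> x \<bullet> (X *v x)"
    using assms by (auto simp: psd_def)
  obtain v :: "'n \<Rightarrow> real^'n" and d where on: "\<And>k l. v k \<bullet> v l = (if k = l then 1 else 0)"
      and ev: "\<And>k. X *v v k = d k *\<^sub>R v k"
    using symmetric_orthonormal_eigenbasis[OF sym] by blast
  have d: "0 \<le> d k" for k
    using pos[of "v k"] by (simp add: ev on)
  have "0 \<le> x \<bullet> (hadamard X X *v x)" for x
  proof -
    have "x \<bullet> (hadamard X X *v x)
        = (\<Sum>k\<in>UNIV. \<Sum>l\<in>UNIV. d k * d l * (\<Sum>i\<in>UNIV. x $ i * (v k $ i * v l $ i))\<^sup>2)"
      using sum_spectral_matrix_product[of "($) x" v d d]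
      by (simp add: spectral_matrix_eigenbasis[OF on ev] inner_matrix_vector_eq_sum hadamard_def)
    also have "\<dots> \<ge> 0" using d by (simp add: sum_nonneg)
    finally show ?thesis .
  qed
  then show ?thesis using sym by (simp add: psd_def transpose_eq_iff hadamard_def)
qed

text \<open>A zero diagonal entry makes the standard basis vector isotropic, so its whole column
  vanishes. This settles the degenerate case \<open>D = 0\<close> of the theorem.\<close>

lemma psd_zero_diagonal:
  assumes "psd X" "\<And>i. X $ i $ i = 0"
  shows "X = 0"
proof -
  have ip: "axis a 1 \<bullet> (X *v axis b 1) = X $ a $ b" for a b
    by (simp add: inner_axis' matrix_vector_mult_basis column_def)
  have "transpose X = X" "\<And>x. 0 \<le> x \<bullet> (X *v x)" using assms(1) by (auto simp: psd_def)
  then have "axis a 1 \<bullet> (X *v axis b 1) = 0" for a b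
    by (rule psd_form_isotropic[OF _ subspace_UNIV _ UNIV_I UNIV_I]) (simp add: ip assms(2))
  then show ?thesis by (simp add: ip vec_eq_iff)
qed

section \<open>Feasible matrices from positive semidefinite ones\<close>

text \<open>
  The certificate is the entrywise square of \<open>X\<close> with its entries at non-edges moved to the
  diagonal. This adds the Laplacian of a nonnegatively weighted graph, hence preserves
  positive semidefiniteness and the sum of all entries.
\<close>

lemma psd_trace_inner_le_chi_vec:
  fixes E :: "'n::finite set set" and X :: "real^'n^'n"
  assumes E: "simple_graph E" and X: "psd X"
    and D: "D = (\<Sum>i\<in>UNIV. \<Sum>j\<in>UNIV. if {i, j} \<in> E then 0 else (X $ i $ j)\<^sup>2)"
    and "0 < D"
  shows "trace_inner X X \<le> D * chi_vec E"
proof -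
  define w where "w i j = (if {i, j} \<in> E then 0 else (X $ i $ j)\<^sup>2)" for i j
  define W :: "real^'n^'n"
    where "W = (\<chi> i j. (X $ i $ j)\<^sup>2 - w i j + (if i = j then \<Sum>l\<in>UNIV. w i l else 0))"
  define Z where "Z = (1 / D) *\<^sub>R W"
  have Xsym: "X $ i $ j = X $ j $ i" for i j
    using X by (simp add: psd_def transpose_eq_iff)
  have wsym: "w i j = w j i" for i j by (simp add: w_def Xsym[of i j] insert_commute)
  have w0: "0 \<le> w i j" "w i j \<le> (X $ i $ j)\<^sup>2" for i j by (auto simp: w_def)
  have loop: "{i} \<notin> E" for i using E by (auto simp: simple_graph_def)
  have Dw: "D = (\<Sum>i\<in>UNIV. \<Sum>j\<in>UNIV. w i j)" by (simp add: D w_def)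
  have symW: "transpose W = W"
    unfolding transpose_eq_iff by (auto simp: W_def Xsym wsym)
  have "0 \<le> x \<bullet> (W *v x)" for x
  proof -
    \<comment> \<open>This is twice the quadratic form of the weighted Laplacian; expanding it and
      using the symmetry of \<open>w\<close> gives the bound \<open>lap\<close>.\<close>
    have "0 \<le> (\<Sum>i\<in>UNIV. \<Sum>j\<in>UNIV. w i j * (x $ i - x $ j)\<^sup>2)"
      by (intro sum_nonneg mult_nonneg_nonneg w0) auto
    also have "\<dots> = (\<Sum>i\<in>UNIV. \<Sum>j\<in>UNIV. w i j * (x $ i)\<^sup>2) + (\<Sum>i\<in>UNIV. \<Sum>j\<in>UNIV. w i j * (x $ j)\<^sup>2)
        - 2 * (\<Sum>i\<in>UNIV. \<Sum>j\<in>UNIV. x $ i * x $ j * w i j)"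
      by (simp add: sum_distrib_left flip: sum.distrib sum_subtractf)
         (simp add: power2_eq_square algebra_simps)
    also have "(\<Sum>i\<in>UNIV. \<Sum>j\<in>UNIV. w i j * (x $ j)\<^sup>2) = (\<Sum>i\<in>UNIV. \<Sum>j\<in>UNIV. w i j * (x $ i)\<^sup>2)"
      by (subst sum.swap) (simp add: wsym)
    finally have lap: "(\<Sum>i\<in>UNIV. \<Sum>j\<in>UNIV. x $ i * x $ j * w i j) \<le> (\<Sum>i\<in>UNIV. \<Sum>j\<in>UNIV. w i j * (x $ i)\<^sup>2)"
      by simp
    have "0 \<le> x \<bullet> (hadamard X X *v x)"
      using psd_hadamard_self[OF X] by (simp add: psd_def)
    also have "\<dots> = (\<Sum>i\<in>UNIV. \<Sum>j\<in>UNIV. x $ i * x $ j * (X $ i $ j)\<^sup>2)"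
      by (simp add: inner_matrix_vector_eq_sum hadamard_def power2_eq_square)
    finally have sq: "0 \<le> \<dots>" .
    have "x \<bullet> (W *v x) = (\<Sum>i\<in>UNIV. \<Sum>j\<in>UNIV. x $ i * x $ j * (X $ i $ j)\<^sup>2)
        - (\<Sum>i\<in>UNIV. \<Sum>j\<in>UNIV. x $ i * x $ j * w i j) + (\<Sum>i\<in>UNIV. x $ i * x $ i * (\<Sum>j\<in>UNIV. w i j))"
      by (simp add: inner_matrix_vector_eq_sum W_def ring_distribs sum.distrib sum_subtractf
          if_distrib[where f = "(*) _"] cong: if_cong)
    also have "(\<Sum>i\<in>UNIV. x $ i * x $ i * (\<Sum>j\<in>UNIV. w i j)) = (\<Sum>i\<in>UNIV. \<Sum>j\<in>UNIV. w i j * (x $ i)\<^sup>2)"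
      by (simp add: power2_eq_square mult.commute flip: sum_distrib_right)
    finally show ?thesis using lap sq by simp
  qed
  then have "psd Z"
    using symW \<open>0 < D\<close>
    by (simp add: psd_def Z_def transpose_scalar scaleR_matrix_vector_assoc[symmetric])
  moreover have "trace_inner (mat 1) Z = 1"
  proof -
    have "trace_inner (mat 1) Z = (\<Sum>i\<in>UNIV. W $ i $ i) / D"
      by (simp add: trace_inner_eq_sum Z_def mat_def sum_divide_distrib
          if_distrib[where f = "\<lambda>y. y * _"] if_distrib[where f = "\<lambda>y. y / _"] cong: if_cong)
    \<comment> \<open>Without loops \<open>w i i\<close> is the full squared diagonal entry, so only
      the row sums of \<open>w\<close> remain on the diagonal.\<close>
    also have "(\<Sum>i\<in>UNIV. W $ i $ i) = D"
      by (simp add: W_def Dw) (simp add: w_def loop)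
    finally show ?thesis using \<open>0 < D\<close> by simp
  qed
  moreover have "hadamard Z (adjacency_matrix (complement_graph E)) = 0"
    by (auto simp: hadamard_def adjacency_matrix_def complement_graph_def vec_eq_iff Z_def W_def w_def)
  moreover have "0 \<le> Z $ i $ j" for i j
    using w0 \<open>0 < D\<close> by (simp add: Z_def W_def sum_nonneg)
  ultimately have "Z \<in> vec_feasible E"
    by (simp add: vec_feasible_def) (simp add: psd_def)
  then have "trace_inner all_ones Z \<le> chi_vec E"
    unfolding chi_vec_def by (rule cSUP_upper[OF _ bdd_above_vec_feasible])
  moreover have "trace_inner all_ones Z = trace_inner X X / D"
    by (simp add: trace_inner_eq_sum all_ones_def Z_def W_def Dw sum.distrib sum_subtractf
        power2_eq_square flip: sum_divide_distrib)
  ultimately show ?thesis using \<open>0 < D\<close> by (simp add: divide_simps mult.commute)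
qed

section \<open>Edge counts and the final estimate\<close>

lemma trace_inner_adjacency_matrix:
  assumes "simple_graph E"
  shows "trace_inner (adjacency_matrix E) (adjacency_matrix E) = 2 * real (card E)"
proof -
  \<comment> \<open>The ordered pairs that spell an edge: two for each edge, and disjoint for
    distinct edges.\<close>
  let ?F = "\<lambda>e. {(i, j). {i, j} = e}"
  have "card (?F e) = 2" if "e \<in> E" for e
  proof -
    have "card e = 2" using assms that by (simp add: simple_graph_def)
    then obtain a b where "e = {a, b}" "a \<noteq> b" by (auto simp: card_2_iff)
    then have "?F e = {(a, b), (b, a)}" by (auto simp: doubleton_eq_iff)
    then show ?thesis using \<open>a \<noteq> b\<close> by simp
  qed
  then have "card (\<Union>e\<in>E. ?F e) = 2 * card E"
    by (subst card_UN_disjoint) auto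
  moreover have "(\<Union>e\<in>E. ?F e) = {p. {fst p, snd p} \<in> E}" by auto
  moreover have "trace_inner (adjacency_matrix E) (adjacency_matrix E)
      = (\<Sum>p\<in>UNIV. if {fst p, snd p} \<in> E then 1 else 0)"
    by (simp add: trace_inner_eq_sum adjacency_matrix_def sum.cartesian_product case_prod_unfold)
      (intro sum.cong refl, simp)
  moreover have "\<dots> = real (card {p. {fst p, snd p} \<in> E})"
    by (subst sum.If_cases) auto
  ultimately show ?thesis by simp
qed

text \<open>Bridges the two forms of \<open>D\<close>: a double sum with zeros at edges in the bound
  by \<open>chi_vec E\<close>, and a sum over the complement of \<open>F\<close> in the
  theorem.\<close>

lemma sum_pairs_if:
  fixes f :: "'a::finite \<times> 'b::finite \<Rightarrow> real"
  shows "(\<Sum>i\<in>UNIV. \<Sum>j\<in>UNIV. if (i, j) \<in> F then 0 else f (i, j)) = sum f (- F)"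
  by (simp add: sum.cartesian_product) (rule sum.mono_neutral_cong_right, auto)

theorem theorem1:
  fixes E :: "'n::finite set set" and m :: nat and A :: "real^'n^'n"
  assumes "simple_graph E"
    and "m = card E"
    and "A = adjacency_matrix E"
  shows "min (s_plus A) (s_minus A) \<ge> 2 * real m / chi_vec E"
proof -
  have "transpose A = A"
    by (simp add: assms transpose_eq_iff adjacency_matrix_def insert_commute)
  then obtain v :: "'n \<Rightarrow> real^'n" and d where on: "\<And>k l. v k \<bullet> v l = (if k = l then 1 else 0)"
      and ev: "\<And>k. A *v v k = d k *\<^sub>R v k"
    using symmetric_orthonormal_eigenbasis by blast
  define X where "X = spectral_matrix v (\<lambda>k. max (d k) 0)"
  define Y where "Y = spectral_matrix v (\<lambda>k. max (- d k) 0)"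
  note tr = trace_inner_spectral_matrix[OF on]
  have psd: "psd X" "psd Y" by (auto simp: X_def Y_def intro: psd_spectral_matrix)
  have "spectral_matrix v d = X - Y"
    by (simp add: vec_eq_iff X_def Y_def spectral_matrix_def flip: sum_subtractf left_diff_distrib)
       (intro allI sum.cong refl, simp add: max_def)
  then have AXY: "X $ i $ j - Y $ i $ j = A $ i $ j" for i j
    by (simp add: spectral_matrix_eigenbasis[OF on ev])
  have sX: "s_plus A = trace_inner X X"
    by (simp add: s_plus_def eigenvalues_orthonormal_eigenbasis[OF on ev] X_def tr
        filter_mset_image_mset multiset.map_comp flip: sum_unfold_sum_mset)
       (intro sum.mono_neutral_cong_left, auto simp: power2_eq_square max_def)
  have sY: "s_minus A = trace_inner Y Y"
    by (simp add: s_minus_def eigenvalues_orthonormal_eigenbasis[OF on ev] Y_def tr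
        filter_mset_image_mset multiset.map_comp flip: sum_unfold_sum_mset)
       (intro sum.mono_neutral_cong_left, auto simp: power2_eq_square max_def)
  have "trace_inner X X + trace_inner Y Y = trace_inner (spectral_matrix v d) (spectral_matrix v d)"
    by (simp add: X_def Y_def tr flip: sum.distrib) (intro sum.cong, auto simp: max_def)
  then have total: "trace_inner X X + trace_inner Y Y = 2 * real m"
    by (simp add: spectral_matrix_eigenbasis[OF on ev] assms trace_inner_adjacency_matrix)
  define F where "F = {(i, j). {i, j} \<in> E}"
  define x where "x = (\<lambda>(i, j). X $ i $ j)"
  define y where "y = (\<lambda>(i, j). Y $ i $ j)"
  define D where "D = (\<Sum>p\<in>-F. (x p)\<^sup>2)"
  have xy: "x p = y p" if "p \<notin> F" for p
    using that AXY[of "fst p" "snd p"]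
    by (auto simp: x_def y_def F_def assms adjacency_matrix_def split: prod.splits)
  have split: "sum f UNIV = sum f F + sum f (- F)" for f :: "'n \<times> 'n \<Rightarrow> real"
    using sum.union_disjoint[of F "- F" f] by simp
  have D': "D = (\<Sum>p\<in>-F. (y p)\<^sup>2)" "D = (\<Sum>p\<in>-F. x p * y p)"
    by (simp_all add: D_def xy power2_eq_square)
  have "trace_inner X X = (\<Sum>p\<in>UNIV. (x p)\<^sup>2)" "trace_inner Y Y = (\<Sum>p\<in>UNIV. (y p)\<^sup>2)"
    and trXY: "trace_inner X Y = (\<Sum>p\<in>UNIV. x p * y p)"
    by (simp_all add: trace_inner_eq_sum x_def y_def sum.cartesian_product case_prod_unfold power2_eq_square)
  then have XX: "trace_inner X X = (\<Sum>p\<in>F. (x p)\<^sup>2) + D"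
    and YY: "trace_inner Y Y = (\<Sum>p\<in>F. (y p)\<^sup>2) + D"
    by (simp_all add: split D_def flip: D'(1))
  have "trace_inner X Y = 0"
    by (simp add: X_def Y_def tr) (intro sum.neutral, simp add: max_def)
  then have "(\<Sum>p\<in>F. x p * y p) = - D" by (simp add: trXY split flip: D'(2))
  then have "D\<^sup>2 \<le> (\<Sum>p\<in>F. (x p)\<^sup>2) * (\<Sum>p\<in>F. (y p)\<^sup>2)"
    using Cauchy_Schwarz_ineq_sum[of x y F] by simp
  \<comment> \<open>Expanding the product cancels \<open>D\<^sup>2\<close> and leaves
    \<open>D\<close> times the sum of the two squared norms, which is
    \<open>2 * real m\<close>.\<close>
  then have cs: "D * (2 * real m) \<le> trace_inner X X * trace_inner Y Y"
    unfolding total[symmetric] XX YY by (simp add: power2_eq_square algebra_simps)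
  have nonneg: "0 \<le> trace_inner X X" "0 \<le> trace_inner Y Y"
    by (simp_all add: trace_inner_eq_sum sum_nonneg)
  have "0 \<le> D" by (simp add: D_def sum_nonneg)
  show ?thesis
  proof (cases "D = 0")
    \<comment> \<open>Normalising by \<open>D\<close> is impossible here, but both diagonals vanish,
      so \<open>X\<close> and \<open>Y\<close> are zero and the graph has no edges.\<close>
    case True
    have "(i, i) \<notin> F" for i using assms(1) by (auto simp: F_def simple_graph_def)
    then have "x (i, i) = 0" "y (i, i) = 0" for i
      using True D' xy by (auto simp: D_def sum_nonneg_eq_0_iff)
    then have "X = 0" "Y = 0"
      using psd psd_zero_diagonal by (auto simp: x_def y_def)
    then have "m = 0" using total by (simp add: trace_inner_eq_sum)
    then show ?thesis using nonneg sX sY by simp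
  next
    case False
    then have "0 < D" using \<open>0 \<le> D\<close> by simp
    have boundX: "trace_inner X X \<le> D * chi_vec E"
      using sum_pairs_if[of F "\<lambda>p. (x p)\<^sup>2"]
      by (intro psd_trace_inner_le_chi_vec assms psd \<open>0 < D\<close>) (simp add: D_def F_def x_def cong: if_cong)
    have boundY: "trace_inner Y Y \<le> D * chi_vec E"
      using sum_pairs_if[of F "\<lambda>p. (y p)\<^sup>2"]
      by (intro psd_trace_inner_le_chi_vec assms psd \<open>0 < D\<close>) (simp add: D'(1) F_def y_def cong: if_cong)
    have "D \<le> trace_inner X X" by (simp add: XX sum_nonneg)
    then have chi: "0 < chi_vec E"
      using boundX \<open>0 < D\<close> by (smt (verit) zero_less_mult_pos)
    \<comment> \<open>The bound for \<open>X\<close> enters the estimate for \<open>s_minus\<close>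
      and the bound for \<open>Y\<close> that for \<open>s_plus\<close>; the common factor
      \<open>D\<close> then cancels.\<close>
    have "D * (2 * real m) \<le> D * (chi_vec E * trace_inner Y Y)"
      using cs mult_right_mono[OF boundX nonneg(2)] by (simp add: mult.assoc)
    moreover have "D * (2 * real m) \<le> D * (chi_vec E * trace_inner X X)"
      using cs mult_left_mono[OF boundY nonneg(1)] by (simp add: mult_ac)
    ultimately show ?thesis
      using \<open>0 < D\<close> chi by (simp add: sX sY divide_simps mult.commute)
  qed
qed

end
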